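(* Let $\mathcal D$ be a block design with parameters $(v,b,r,k,\lambda)$ on $V=\{1,\dots,v\}$ with blocks $B_1,\dots,B_b$, and for $i\neq j$ put $\mu_{ij}=|B_i\cap B_j|$. Then the matrix $\mathcal Z^+=\mathcal Z^+(\mathcal D)$ is an incidence matrix of another block design $\mathcal D'$ if and only if $\mu_{ij}$, as a function of $i,j\in\{1,\dots,b\}$ with $i\neq j$, takes at most two values $\mu_1$ and $\mu_2$, for which $$\mu_1=\mu_2\qquad\text{or}\qquad \mu_1+\mu_2=2k-\frac v2 .$$ In this case, the block design $\mathcal D'$ has parameters $(v',b',r',k',\lambda')$ where $$v'=b,\quad b'=\frac{v(v-1)}2,\quad r'=k(v-k),\quad k'=2(r-\lambda),\quad \lambda'=2\mu_1^2+\mu_1(v-4k)+k^2 .$$ Alternatively, $\lambda'$ can be obtained by $$\lambda'=\frac{k(v-k)(2r-2\lambda-1)}{b-1}.$$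
   Context: A block design (BIBD) with parameters $(v,b,r,k,\lambda)$ (with $b,r,k,\lambda$ positive integers and $k<v$) on a finite set $V$ with $|V|=v$ is a collection (repetitions allowed) of $b$ blocks, each a $k$-element subset of $V$, such that every element of $V$ lies in exactly $r$ blocks and every pair of distinct elements of $V$ is contained in exactly $\lambda$ blocks. The blocks are ordered in some way as $B_1,\dots,B_b$. The incidence matrix of a design on points $1,\dots,v$ with blocks $B_1,\dots,B_b$ is the $v\times b$ matrix whose $(i,j)$ entry is $1$ if $i\in B_j$ and $0$ otherwise. For a block design $\mathcal D$ with blocks $B_1,\dots,B_b$ and an unordered pair $\{x,y\}$ of distinct elements of $V$, let $\mathcal Z^+(x,y)$ be the column vector of length $b$ with $j$th entry $\mathcal Z^+_j(x,y)=|\chi_{B_j}(x)-\chi_{B_j}(y)|\in\{0,1\}$, where $\chi_{B}$ is the characteristic function of $B$. The matrix $\mathcal Z^+=\mathcal Z^+(\mathcal D)$ is the $b\times\frac{v(v-1)}2$ matrix whose columns are the vectors $\mathcal Z^+(x,y)$, where $\{x,y\}$ runs over all unordered pairs of distinct elements of $V$. Thus $\mathcal D'$, if it exists, has point set $\{1,\dots,b\}$ and one block $\{j:\mathcal Z_j^+(x,y)=1\}$ for each unordered pair $\{x,y\}$. *)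

theory Defs
  imports Complex_Main "HOL-Library.Indicator_Function" "Jordan_Normal_Form.Matrix"
begin

text \<open>The blocks form a family \<open>B 1, \<dots>, B b\<close>, so that repeated blocks are allowed;
  the values of \<open>B\<close> outside \<open>{1..b}\<close> are irrelevant. The last argument \<open>l\<close> is the
  parameter usually written as lambda.\<close>

definition block_design ::
  "'a set \<Rightarrow> (nat \<Rightarrow> 'a set) \<Rightarrow> nat \<Rightarrow> nat \<Rightarrow> nat \<Rightarrow> nat \<Rightarrow> nat \<Rightarrow> bool" where
  "block_design V B v b r k l \<longleftrightarrow>
     finite V \<and> card V = v \<and>
     0 < b \<and> 0 < r \<and> 0 < k \<and> 0 < l \<and> k < v \<and>
     (\<forall>j\<in>{1..b}. B j \<subseteq> V \<and> card (B j) = k) \<and>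
     (\<forall>x\<in>V. card {j\<in>{1..b}. x \<in> B j} = r) \<and>
     (\<forall>x\<in>V. \<forall>y\<in>V. x \<noteq> y \<longrightarrow> card {j\<in>{1..b}. x \<in> B j \<and> y \<in> B j} = l)"

text \<open>Points and blocks are numbered from 1, whereas rows and columns of the library's
  matrices are numbered from 0; hence the shifts by \<open>Suc\<close> below.\<close>

definition incidence_mat :: "nat \<Rightarrow> nat \<Rightarrow> (nat \<Rightarrow> nat set) \<Rightarrow> int mat" where
  "incidence_mat v b B = mat v b (\<lambda>(i, j). if Suc i \<in> B (Suc j) then 1 else 0)"

definition zplus_vec :: "nat \<Rightarrow> (nat \<Rightarrow> 'a set) \<Rightarrow> 'a \<Rightarrow> 'a \<Rightarrow> int vec" where
  "zplus_vec b B x y =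
     vec b (\<lambda>j. \<bar>indicator (B (Suc j)) x - indicator (B (Suc j)) y\<bar>)"

text \<open>The list \<open>ps\<close> runs exactly once over the unordered pairs of distinct elements of \<open>V\<close>,
  each of them being given by one of its two orderings. It fixes the order of the columns of
  the matrix below; \<open>zplus_vec\<close> is symmetric in the two points.\<close>

definition pair_enumeration :: "'a set \<Rightarrow> ('a \<times> 'a) list \<Rightarrow> bool" where
  "pair_enumeration V ps \<longleftrightarrow>
     distinct (map (\<lambda>(x, y). {x, y}) ps) \<and>
     set (map (\<lambda>(x, y). {x, y}) ps) = {{x, y} | x y. x \<in> V \<and> y \<in> V \<and> x \<noteq> y}"

definition zplus_mat :: "nat \<Rightarrow> (nat \<Rightarrow> 'a set) \<Rightarrow> ('a \<times> 'a) list \<Rightarrow> int mat" where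
  "zplus_mat b B ps = mat_of_cols b (map (\<lambda>(x, y). zplus_vec b B x y) ps)"

text \<open>The set of values taken by \<open>|B i \<inter> B j|\<close> for distinct indices (not distinct blocks).\<close>

definition intersection_numbers :: "nat \<Rightarrow> (nat \<Rightarrow> 'a set) \<Rightarrow> nat set" where
  "intersection_numbers b B =
     {card (B i \<inter> B j) | i j. i \<in> {1..b} \<and> j \<in> {1..b} \<and> i \<noteq> j}"

end

theory Submission
  imports Defs
begin

text \<open>Two blocks of size \<open>k\<close> meeting in \<open>m\<close> points both separate exactly
  \<open>m (v - 2 k + m) + (k - m)\<^sup>2\<close> pairs of points. Hence the pairs form a block design on the
  blocks iff this quadratic function takes one value on the intersection numbers; since the
  roots of \<open>2 m\<^sup>2 + (v - 4 k) m = const\<close> sum to \<open>2 k - v / 2\<close>, that is the stated condition.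
  The second formula for the new \<open>l\<close> is the identity \<open>r (k - 1) = l (v - 1)\<close> in the new design.\<close>

section \<open>Double counting and parameter inequalities for block designs\<close>

lemma block_design_cong:
  assumes "\<And>j. j \<in> {1..b} \<Longrightarrow> B j = B' j"
  shows "block_design V B v b r k l \<longleftrightarrow> block_design V B' v b r k l"
proof -
  have "{j\<in>{1..b}. x \<in> B j} = {j\<in>{1..b}. x \<in> B' j}"
    and "{j\<in>{1..b}. x \<in> B j \<and> y \<in> B j} = {j\<in>{1..b}. x \<in> B' j \<and> y \<in> B' j}" for x y
    using assms by auto
  then show ?thesis
    unfolding block_design_def using assms by simp
qed

text \<open>For a fixed point \<open>x\<close>, count the incidences of points
  \<open>y \<noteq> x\<close> with blocks through \<open>x\<close>, once by blocks and once by
  points.\<close>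

lemma block_design_replication_eq:
  assumes "block_design V B v b r k l"
  shows "r * (k - 1) = l * (v - 1)"
proof -
  have fin: "finite V" and cardV: "card V = v" and kv: "k < v"
    and blk: "\<And>j. j \<in> {1..b} \<Longrightarrow> B j \<subseteq> V \<and> card (B j) = k"
    and rep: "\<And>x. x \<in> V \<Longrightarrow> card {j\<in>{1..b}. x \<in> B j} = r"
    and lam: "\<And>x y. x \<in> V \<Longrightarrow> y \<in> V \<Longrightarrow> x \<noteq> y \<Longrightarrow> card {j\<in>{1..b}. x \<in> B j \<and> y \<in> B j} = l"
    using assms unfolding block_design_def by auto
  obtain x where x: "x \<in> V"
    using cardV kv by fastforce
  let ?J = "{j\<in>{1..b}. x \<in> B j}"
  have "card {y \<in> V - {x}. y \<in> B j} = k - 1" if "j \<in> ?J" for j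
  proof -
    have "{y \<in> V - {x}. y \<in> B j} = B j - {x}"
      using blk that by blast
    then show ?thesis
      using blk that by (simp add: card_Diff_singleton)
  qed
  then have "(\<Sum>y\<in>V - {x}. card {j\<in>?J. y \<in> B j}) = (k - 1) * card ?J"
    using fin by (intro sum_multicount) auto
  moreover have "card {j\<in>?J. y \<in> B j} = l" if "y \<in> V - {x}" for y
  proof -
    have "{j\<in>?J. y \<in> B j} = {j\<in>{1..b}. x \<in> B j \<and> y \<in> B j}"
      by blast
    then show ?thesis
      using lam[of x y] x that by auto
  qed
  ultimately show ?thesis
    using fin cardV x rep by (simp add: card_Diff_singleton mult.commute)
qed

text \<open>If \<open>r \<le> l\<close>, then
  \<open>r * (k - 1) \<le> l * (k - 1) < l * (v - 1)\<close>, against the counting identity. It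
  makes the truncated difference \<open>r - l\<close> a genuine and positive one.\<close>

lemma block_design_index_less_replication:
  assumes "block_design V B v b r k l"
  shows "l < r"
proof (rule ccontr)
  assume "\<not> l < r"
  moreover have "r * (k - 1) = l * (v - 1)" "k < v" "0 < k" "0 < l"
    using assms block_design_replication_eq[OF assms] by (simp_all add: block_design_def)
  moreover have "r * (k - 1) \<le> l * (k - 1)"
    using calculation by (intro mult_right_mono) auto
  moreover have "l * (k - 1) < l * (v - 1)"
    using calculation by (intro mult_strict_left_mono) auto
  ultimately show False
    by simp
qed

text \<open>From \<open>0 < l < r \<le> b\<close>. Two distinct indices therefore exist, so there is
  an intersection number, and the denominator \<open>b - 1\<close> is nonzero.\<close>

lemma block_design_two_le_blocks:
  assumes "block_design V B v b r k l"
  shows "2 \<le> b"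
proof -
  obtain x where "x \<in> V"
    using assms by (fastforce simp: block_design_def)
  then have "r = card {j\<in>{1..b}. x \<in> B j}"
    using assms by (simp add: block_design_def)
  also have "\<dots> \<le> card {1..b}"
    by (intro card_mono) auto
  finally show ?thesis
    using block_design_index_less_replication[OF assms] assms
    by (simp add: block_design_def)
qed

section \<open>Pairs of points separated by blocks\<close>

text \<open>The condition for an entry 1 in \<open>zplus_vec\<close>: the two indicators differ by 1
  in absolute value.\<close>

definition separates :: "'a set \<Rightarrow> 'a \<times> 'a \<Rightarrow> bool" where
  "separates A p \<longleftrightarrow> (fst p \<in> A) \<noteq> (snd p \<in> A)"

text \<open>The candidate blocks of the new design. They are numbered from 1 and list positions from
  0, hence \<open>c - 1\<close>.\<close>

definition pair_block :: "nat \<Rightarrow> (nat \<Rightarrow> 'a set) \<Rightarrow> ('a \<times> 'a) list \<Rightarrow> nat \<Rightarrow> nat set" where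
  "pair_block b B ps c = {j\<in>{1..b}. separates (B j) (ps ! (c - 1))}"

lemma pair_enumeration_nth:
  assumes "pair_enumeration V ps" "c < length ps"
  shows "fst (ps ! c) \<in> V" "snd (ps ! c) \<in> V" "fst (ps ! c) \<noteq> snd (ps ! c)"
proof -
  obtain x y where xy: "ps ! c = (x, y)"
    by fastforce
  then have "(x, y) \<in> set ps"
    using assms(2) nth_mem by metis
  from imageI[OF this, of "\<lambda>(x, y). {x, y}"] have "{x, y} \<in> set (map (\<lambda>(x, y). {x, y}) ps)"
    by simp
  also have "\<dots> = {{x, y} | x y. x \<in> V \<and> y \<in> V \<and> x \<noteq> y}"
    using assms(1) unfolding pair_enumeration_def by blast
  finally have "\<exists>x' y'. {x, y} = {x', y'} \<and> x' \<in> V \<and> y' \<in> V \<and> x' \<noteq> y'"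
    by blast
  then have "x \<in> V \<and> y \<in> V \<and> x \<noteq> y"
    by (auto simp: doubleton_eq_iff)
  then show "fst (ps ! c) \<in> V" "snd (ps ! c) \<in> V" "fst (ps ! c) \<noteq> snd (ps ! c)"
    by (simp_all add: xy)
qed

lemma length_pair_enumeration:
  assumes "pair_enumeration V ps" "finite V"
  shows "real (length ps) = real (card V) * (real (card V) - 1) / 2"
proof -
  have "length ps = card (set (map (\<lambda>(x, y). {x, y}) ps))"
    using assms(1) distinct_card[of "map (\<lambda>(x, y). {x, y}) ps"] by (simp add: pair_enumeration_def)
  also have "set (map (\<lambda>(x, y). {x, y}) ps) = {S. S \<subseteq> V \<and> card S = 2}"
    using assms(1) unfolding pair_enumeration_def by (auto simp: card_2_iff)
  also have "card \<dots> = card V choose 2"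
    using assms(2) by (rule n_subsets)
  \<comment> \<open>Over the reals the generalized binomial expands into a product, which avoids
    division of naturals.\<close>
  finally have "real (length ps) = real (card V) gchoose 2"
    by (simp add: binomial_gbinomial)
  then show ?thesis
    by (simp add: gbinomial_prod_rev numeral_2_eq_2)
qed

text \<open>\<open>A\<close> and \<open>C\<close> cut \<open>V\<close> into four cells. Both sets
  split a pair iff its points lie in opposite cells: \<open>A \<inter> C\<close> against the outside
  of both, or \<open>A - C\<close> against \<open>C - A\<close>.\<close>

lemma card_pairs_separated:
  assumes ps: "pair_enumeration V ps" and V: "finite V" "A \<subseteq> V" "C \<subseteq> V"
  shows "card {c\<in>{1..length ps}. separates A (ps ! (c - 1)) \<and> separates C (ps ! (c - 1))} =
    card (A \<inter> C) * card (V - (A \<union> C)) + card (A - C) * card (C - A)"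
proof -
  let ?N = "{c\<in>{1..length ps}. separates A (ps ! (c - 1)) \<and> separates C (ps ! (c - 1))}"
  let ?u = "\<lambda>(x, y). {x, y}"
  let ?W = "(A \<inter> C) \<times> (V - (A \<union> C)) \<union> (A - C) \<times> (C - A)"
  have finite: "finite A" "finite C"
    using V finite_subset by blast+
  have dist: "distinct (map ?u ps)"
    and pairs: "set (map ?u ps) = {{x, y} | x y. x \<in> V \<and> y \<in> V \<and> x \<noteq> y}"
    using ps unfolding pair_enumeration_def by auto
  \<comment> \<open>Positions are traded for unordered pairs, each of which is listed only
    once.\<close>
  have "inj_on (\<lambda>c. ?u (ps ! (c - 1))) ?N"
  proof (rule inj_onI)
    fix c d assume cd: "c \<in> ?N" "d \<in> ?N" and "?u (ps ! (c - 1)) = ?u (ps ! (d - 1))"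
    moreover have "c - 1 < length ps" "d - 1 < length ps"
      using cd by auto
    ultimately have "c - 1 = d - 1"
      using nth_eq_iff_index_eq[OF dist, of "c - 1" "d - 1"] by (simp del: One_nat_def)
    then show "c = d"
      using cd by auto
  qed
  then have "card ?N = card ((\<lambda>c. ?u (ps ! (c - 1))) ` ?N)"
    by (rule card_image[symmetric])
  also have "(\<lambda>c. ?u (ps ! (c - 1))) ` ?N = ?u ` ?W"
  proof (intro equalityI subsetI)
    fix S assume "S \<in> (\<lambda>c. ?u (ps ! (c - 1))) ` ?N"
    then obtain c where c: "c \<in> ?N" "S = ?u (ps ! (c - 1))"
      by blast
    obtain x y where xy: "ps ! (c - 1) = (x, y)"
      by fastforce
    have "c - 1 < length ps"
      using c(1) by auto
    then have "x \<in> V" "y \<in> V"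
      using pair_enumeration_nth[OF ps] xy by fastforce+
    moreover have "separates A (x, y)" "separates C (x, y)"
      using c(1) unfolding xy[symmetric] by blast+
    \<comment> \<open>The orientation chosen by \<open>ps\<close> is arbitrary, so it need not be
      the one used in \<open>?W\<close>.\<close>
    ultimately have "(x, y) \<in> ?W \<or> (y, x) \<in> ?W"
      unfolding separates_def by simp blast
    moreover have "S = ?u (x, y)" "S = ?u (y, x)"
      using c(2) unfolding xy by auto
    ultimately show "S \<in> ?u ` ?W"
      by (metis image_eqI)
  next
    fix S assume "S \<in> ?u ` ?W"
    then obtain p where p: "p \<in> ?W" "S = ?u p"
      by (elim imageE)
    obtain x y where "p = (x, y)"
      by fastforce
    with p have xy: "(x, y) \<in> ?W" "S = {x, y}"
      by simp_all
    then have "x \<in> V" "y \<in> V" "x \<noteq> y"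
      using V by auto
    then have "S \<in> set (map ?u ps)"
      using xy(2) unfolding pairs by blast
    then obtain c where c: "c < length ps" "?u (ps ! c) = S"
      by (auto simp: in_set_conv_nth)
    then have "ps ! c = (x, y) \<or> ps ! c = (y, x)"
      using xy(2) by (cases "ps ! c") (auto simp: doubleton_eq_iff)
    then have "Suc c \<in> ?N"
      using c(1) xy(1) by (auto simp: separates_def)
    then show "S \<in> (\<lambda>c. ?u (ps ! (c - 1))) ` ?N"
      using c(2) by (intro image_eqI[of _ _ "Suc c"]) auto
  qed
  \<comment> \<open>Every pair in \<open>?W\<close> has its first point in \<open>A\<close> and its
    second outside \<open>A\<close>, so no pair occurs in both orientations.\<close>
  also have "card (?u ` ?W) = card ?W"
    by (rule card_image, rule inj_onI) (auto simp: doubleton_eq_iff)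
  also have "\<dots> = card (A \<inter> C) * card (V - (A \<union> C)) + card (A - C) * card (C - A)"
    using V finite by (subst card_Un_disjoint) (auto simp: card_cartesian_product)
  finally show ?thesis .
qed

section \<open>The quadratic function of the intersection size\<close>

text \<open>The formula for the new index, with \<open>m\<close> in place of \<mu>1; it is
  real-valued because \<open>v - 4 * k\<close> may be negative.\<close>

definition common_separations :: "nat \<Rightarrow> nat \<Rightarrow> nat \<Rightarrow> real" where
  "common_separations v k m = 2 * (real m)\<^sup>2 + real m * (real v - 4 * real k) + (real k)\<^sup>2"

lemma common_separations_eq_iff:
  "common_separations v k m = common_separations v k n \<longleftrightarrow>
    m = n \<or> real m + real n = 2 * real k - real v / 2"
proof -
  have "common_separations v k m - common_separations v k n =
    2 * (real m - real n) * (real m + real n - (2 * real k - real v / 2))"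
    unfolding common_separations_def by (simp add: algebra_simps power2_eq_square)
  then have "common_separations v k m = common_separations v k n \<longleftrightarrow>
    2 * (real m - real n) * (real m + real n - (2 * real k - real v / 2)) = 0"
    by linarith
  then show ?thesis
    by simp
qed

text \<open>With \<open>m = card (A \<inter> C)\<close>, the other three cells have sizes
  \<open>k - m\<close>, \<open>k - m\<close> and \<open>v - 2 * k + m\<close>.\<close>

lemma card_common_separations:
  assumes "pair_enumeration V ps" "finite V" "A \<subseteq> V" "C \<subseteq> V" "card A = k" "card C = k"
  shows "real (card {c\<in>{1..length ps}. separates A (ps ! (c - 1)) \<and> separates C (ps ! (c - 1))}) =
    common_separations (card V) k (card (A \<inter> C))"
proof -
  have fin: "finite A" "finite C"
    using assms finite_subset by blast+
  have 1: "real (card (A - C)) = real k - real (card (A \<inter> C))"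
    using fin assms(5) card_Int_Diff[of A C] by simp
  have 2: "real (card (C - A)) = real k - real (card (A \<inter> C))"
    using fin assms(6) card_Int_Diff[of C A] by (simp add: Int_commute)
  have "card V = card (A \<union> C) + card (V - (A \<union> C))"
    using assms card_Int_Diff[of V "A \<union> C"] by (simp add: Int_absorb1)
  then have 3: "real (card (V - (A \<union> C))) = real (card V) - 2 * real k + real (card (A \<inter> C))"
    using card_Un_Int[OF fin] assms(5,6) by simp
  show ?thesis
    unfolding card_pairs_separated[OF assms(1-4)] common_separations_def
    by (simp add: 1 2 3 algebra_simps power2_eq_square)
qed

section \<open>The pair blocks as a design on the block indices\<close>

text \<open>Among the \<open>r\<close> blocks through either point, \<open>l\<close> contain both,
  so \<open>r - l\<close> contain that point alone. As \<open>0 < l\<close>, some block contains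
  both points and does not separate them, which gives the strict bound a design requires.\<close>

lemma card_pair_block:
  assumes D: "block_design V B v b r k l" and ps: "pair_enumeration V ps"
    and c: "c \<in> {1..length ps}"
  shows "card (pair_block b B ps c) = 2 * (r - l)" "card (pair_block b B ps c) < b"
proof -
  obtain x y where xy: "ps ! (c - 1) = (x, y)"
    by fastforce
  have "c - 1 < length ps"
    using c by auto
  then have V: "x \<in> V" "y \<in> V" "x \<noteq> y"
    using pair_enumeration_nth[OF ps] xy by fastforce+
  let ?X = "{j\<in>{1..b}. x \<in> B j}" and ?Y = "{j\<in>{1..b}. y \<in> B j}"
    and ?XY = "{j\<in>{1..b}. x \<in> B j \<and> y \<in> B j}"
  have card: "card ?X = r" "card ?Y = r" "card ?XY = l" "0 < l"
    using D V unfolding block_design_def by auto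
  have "pair_block b B ps c = (?X - ?XY) \<union> (?Y - ?XY)"
    unfolding pair_block_def separates_def xy by auto
  moreover have "card (?X - ?XY) = r - l" "card (?Y - ?XY) = r - l"
    using card by (subst card_Diff_subset; force)+
  ultimately show "card (pair_block b B ps c) = 2 * (r - l)"
    by (simp only:) (subst card_Un_disjoint; auto)
  have "?XY \<noteq> {}"
  proof
    assume "?XY = {}"
    with card(3,4) show False
      by (simp only: card.empty)
  qed
  then obtain j where "j \<in> {1..b}" "j \<notin> pair_block b B ps c"
    unfolding pair_block_def separates_def xy by auto
  then have "pair_block b B ps c \<subset> {1..b}"
    unfolding pair_block_def by blast
  then show "card (pair_block b B ps c) < b"
    using psubset_card_mono[of "{1..b}"] by simp
qed

text \<open>A design needs a positive index. The value is a nonnegative product plus the square of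
  \<open>k - m\<close>; if the square vanishes, the product is \<open>k * (v - k)\<close>. The
  second assumption says that a union of two blocks fits into \<open>V\<close>.\<close>

lemma common_separations_pos:
  assumes "m \<le> k" "2 * k \<le> v + m" "0 < k" "k < v"
  shows "0 < common_separations v k m"
proof -
  have eq: "common_separations v k m = real m * (real v + real m - 2 * real k) + (real k - real m)\<^sup>2"
    unfolding common_separations_def by (simp add: algebra_simps power2_eq_square)
  have "real (2 * k) \<le> real (v + m)"
    using assms(2) of_nat_le_iff by blast
  then have nonneg: "0 \<le> real m * (real v + real m - 2 * real k)"
    by simp
  show ?thesis
  proof (cases "m = k")
    case True
    then show ?thesis
      using assms unfolding eq by simp
  next
    case False
    then have "0 < (real k - real m)\<^sup>2"
      by simp
    then show ?thesis
      using nonneg eq by linarith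
  qed
qed

text \<open>Replication number and block size are constant automatically, so only the pair condition
  remains, and it asks for a constant number of common separations.\<close>

lemma block_design_pair_block_iff:
  assumes D: "block_design V B v b r k l" and ps: "pair_enumeration V ps"
  shows "block_design {1..b} (pair_block b B ps) b (length ps) r' k' l' \<longleftrightarrow>
    r' = k * (v - k) \<and> k' = 2 * (r - l) \<and>
    (\<forall>m \<in> intersection_numbers b B. common_separations v k m = real l')"
    (is "?L \<longleftrightarrow> ?R")
proof -
  let ?P = "pair_block b B ps" and ?n = "length ps"
  have V: "finite V" "card V = v" and kv: "0 < k" "k < v"
    and blk: "\<And>j. j \<in> {1..b} \<Longrightarrow> B j \<subseteq> V \<and> card (B j) = k"
    using D unfolding block_design_def by auto
  note b = block_design_two_le_blocks[OF D]
  note rl = block_design_index_less_replication[OF D]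
  have "2 \<le> v"
    using kv by linarith
  then have n: "0 < ?n"
    using length_pair_enumeration[OF ps V(1)] V(2) by (cases ps) auto
  have row2: "real (card {c\<in>{1..?n}. i \<in> ?P c \<and> j \<in> ?P c}) =
      common_separations v k (card (B i \<inter> B j))" if "i \<in> {1..b}" "j \<in> {1..b}" for i j
    using card_common_separations[OF ps V(1), of "B i" "B j" k] blk that V(2)
    by (simp add: pair_block_def)
  \<comment> \<open>The diagonal case of \<open>row2\<close>: a block meets itself in
    \<open>k\<close> points.\<close>
  have row1: "card {c\<in>{1..?n}. i \<in> ?P c} = k * (v - k)" if "i \<in> {1..b}" for i
  proof -
    have "real (card {c\<in>{1..?n}. i \<in> ?P c}) = common_separations v k k"
      using row2[OF that that] blk that by simp
    also have "\<dots> = real (k * (v - k))"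
      using kv by (simp add: common_separations_def algebra_simps power2_eq_square)
    finally show ?thesis
      using of_nat_eq_iff by blast
  qed
  have pos: "0 < common_separations v k m" if m: "m \<in> intersection_numbers b B" for m
  proof -
    obtain i j where ij: "i \<in> {1..b}" "j \<in> {1..b}" "m = card (B i \<inter> B j)"
      using m unfolding intersection_numbers_def by blast
    then have fin: "finite (B i)" "finite (B j)"
      using blk V(1) finite_subset by blast+
    have "m \<le> k"
      using ij blk fin card_mono[of "B i" "B i \<inter> B j"] by auto
    moreover have "card (B i \<union> B j) \<le> v"
      using ij blk V card_mono[of V "B i \<union> B j"] by simp
    then have "2 * k \<le> v + m"
      using card_Un_Int[OF fin] ij blk by simp
    ultimately show ?thesis
      using common_separations_pos kv by blast
  qed
  have "card (B 1 \<inter> B 2) \<in> intersection_numbers b B"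
    unfolding intersection_numbers_def using b by force
  \<comment> \<open>The intersection number just found keeps the condition in \<open>?R\<close> from
    being vacuous.\<close>
  then have l': "0 < l'" if ?R
    using that pos by force
  \<comment> \<open>One point and one block of the new design suffice to read off \<open>r'\<close>
    and \<open>k'\<close>.\<close>
  have one: "1 \<in> {1..b}" "1 \<in> {1..?n}"
    using b n by (auto simp: Suc_le_eq)
  have pairs: "(\<forall>m \<in> intersection_numbers b B. common_separations v k m = real l') \<longleftrightarrow>
    (\<forall>i\<in>{1..b}. \<forall>j\<in>{1..b}. i \<noteq> j \<longrightarrow> card {c\<in>{1..?n}. i \<in> ?P c \<and> j \<in> ?P c} = l')"
  proof -
    have "(common_separations v k (card (B i \<inter> B j)) = real l') \<longleftrightarrow>
       card {c\<in>{1..?n}. i \<in> ?P c \<and> j \<in> ?P c} = l'" if "i \<in> {1..b}" "j \<in> {1..b}" for i j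
      using row2[OF that] by (metis of_nat_eq_iff)
    then show ?thesis
      unfolding intersection_numbers_def by blast
  qed
  show ?thesis
  proof
    assume L: ?L
    then have "r' = k * (v - k)"
      using row1 one unfolding block_design_def by metis
    moreover have "k' = 2 * (r - l)"
      using L card_pair_block(1)[OF D ps] one unfolding block_design_def by metis
    ultimately show ?R
      using L unfolding pairs block_design_def by blast
  next
    assume R: ?R
    have sub: "?P c \<subseteq> {1..b}" for c
      unfolding pair_block_def by blast
    have "2 * (r - l) < b"
      using card_pair_block[OF D ps one(2)] by simp
    then show ?L
      using R l' kv rl n row1 sub card_pair_block(1)[OF D ps]
      unfolding pairs block_design_def by simp
  qed
qed

section \<open>From matrix equality to equality of blocks\<close>

text \<open>The matrix sees only the points \<open>1\<close> to \<open>b\<close> of each block,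
  hence the intersection with \<open>{1..b}\<close>.\<close>

lemma zplus_mat_eq_incidence_mat_iff:
  "zplus_mat b B ps = incidence_mat v' b' B' \<longleftrightarrow>
    v' = b \<and> b' = length ps \<and> (\<forall>c\<in>{1..b'}. B' c \<inter> {1..b} = pair_block b B ps c)"
    (is "?L \<longleftrightarrow> ?R")
proof -
  \<comment> \<open>Passes between indices from 1 in designs and indices from 0 in matrices.\<close>
  have Suc: "(\<forall>c\<in>{1..m}. Q c) \<longleftrightarrow> (\<forall>c<m. Q (Suc c))" for Q :: "nat \<Rightarrow> bool" and m
  proof -
    have "{1..m} = Suc ` {..<m}"
      by (simp add: image_Suc_lessThan)
    then show ?thesis
      by auto
  qed
  have entry: "zplus_mat b B ps $$ (i, c) = (if separates (B (Suc i)) (ps ! c) then 1 else 0)"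
    if "i < b" "c < length ps" for i c
    using that unfolding zplus_mat_def zplus_vec_def mat_of_cols_def separates_def
    by (cases "ps ! c") (simp add: indicator_def)
  have "?L \<longleftrightarrow> v' = b \<and> b' = length ps \<and> (\<forall>i<b. \<forall>c<length ps.
    separates (B (Suc i)) (ps ! c) \<longleftrightarrow> Suc i \<in> B' (Suc c))"
  proof -
    have dim: "dim_row (zplus_mat b B ps) = b" "dim_col (zplus_mat b B ps) = length ps"
      "dim_row (incidence_mat v' b' B') = v'" "dim_col (incidence_mat v' b' B') = b'"
      unfolding zplus_mat_def incidence_mat_def by simp_all
    have "zplus_mat b B ps $$ (i, c) = incidence_mat b (length ps) B' $$ (i, c) \<longleftrightarrow>
      (separates (B (Suc i)) (ps ! c) \<longleftrightarrow> Suc i \<in> B' (Suc c))"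
      if "i < b" "c < length ps" for i c
      using that by (simp add: entry incidence_mat_def)
    then show ?thesis
      unfolding mat_eq_iff dim by blast
  qed
  also have "\<dots> \<longleftrightarrow> v' = b \<and> b' = length ps \<and>
    (\<forall>c\<in>{1..length ps}. \<forall>j\<in>{1..b}. separates (B j) (ps ! (c - 1)) \<longleftrightarrow> j \<in> B' c)"
    unfolding Suc by auto
  also have "\<dots> \<longleftrightarrow> ?R"
    unfolding pair_block_def by blast
  finally show ?thesis .
qed

text \<open>In a design the blocks lie inside the point set, so the intersection with
  \<open>{1..b}\<close> disappears and the matrix determines every block with index in
  \<open>{1..b'}\<close>.\<close>

lemma block_design_zplus_mat_iff:
  assumes "block_design V B v b r k l" "pair_enumeration V ps"
  shows "block_design {1..v'} B' v' b' r' k' l' \<and> zplus_mat b B ps = incidence_mat v' b' B' \<longleftrightarrow>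
    v' = b \<and> b' = length ps \<and> (\<forall>c\<in>{1..b'}. B' c = pair_block b B ps c) \<and>
    r' = k * (v - k) \<and> k' = 2 * (r - l) \<and>
    (\<forall>m \<in> intersection_numbers b B. common_separations v k m = real l')"
    (is "?L \<longleftrightarrow> ?R")
proof
  assume L: ?L
  then have eq: "v' = b" "b' = length ps"
    and blocks: "\<forall>c\<in>{1..b'}. B' c \<inter> {1..b} = pair_block b B ps c"
    unfolding zplus_mat_eq_incidence_mat_iff by auto
  moreover have "\<forall>c\<in>{1..b'}. B' c \<subseteq> {1..b}"
    using L eq unfolding block_design_def by blast
  ultimately have B': "\<forall>c\<in>{1..b'}. B' c = pair_block b B ps c"
    by blast
  then have "block_design {1..b} (pair_block b B ps) b (length ps) r' k' l'"
    using L eq block_design_cong[of b' B' "pair_block b B ps"] by simp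
  then show ?R
    using eq B' block_design_pair_block_iff[OF assms] by blast
next
  assume R: ?R
  then have "block_design {1..b} (pair_block b B ps) b (length ps) r' k' l'"
    using block_design_pair_block_iff[OF assms] by blast
  then have "block_design {1..v'} B' v' b' r' k' l'"
    using R block_design_cong[of b' B' "pair_block b B ps"] by simp
  moreover have "\<forall>c\<in>{1..b'}. B' c \<inter> {1..b} = pair_block b B ps c"
    using R unfolding pair_block_def by auto
  ultimately show ?L
    using R unfolding zplus_mat_eq_incidence_mat_iff by blast
qed

section \<open>At most two intersection numbers\<close>

text \<open>Any two different members of \<open>M\<close> have the same prescribed sum, so one
  member determines any other. Conversely, \<open>nat\<close> turns the common real value into a
  natural \<open>l'\<close>. The case \<open>m1 = m2\<close> covers singletons.\<close>

lemma common_separations_constant_iff: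
  assumes M: "M \<noteq> {}" and nat: "\<And>m. m \<in> M \<Longrightarrow> common_separations v k m \<in> \<nat>"
  shows "(\<exists>l'. \<forall>m \<in> M. common_separations v k m = real l') \<longleftrightarrow>
    (\<exists>m1 m2. M = {m1, m2} \<and> (m1 = m2 \<or> real m1 + real m2 = 2 * real k - real v / 2))"
  (is "?L \<longleftrightarrow> ?R")
proof
  assume ?L
  then have eq: "m = n \<or> real m + real n = 2 * real k - real v / 2" if "m \<in> M" "n \<in> M" for m n
    using that common_separations_eq_iff by metis
  obtain m where m: "m \<in> M"
    using M by blast
  show ?R
  proof (cases "M = {m}")
    case True
    then show ?thesis
      by auto
  next
    case False
    then obtain n where n: "n \<in> M" "n \<noteq> m"
      using m by blast
    \<comment> \<open>Both \<open>p\<close> and \<open>n\<close> equal the prescribed sum minus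
      \<open>m\<close>.\<close>
    have "p = n" if "p \<in> M" "p \<noteq> m" for p
      using eq[of m n] eq[of m p] m n that by simp
    then have "M = {m, n}"
      using m n by blast
    then show ?thesis
      using eq m n by blast
  qed
next
  assume ?R
  then obtain m1 m2 where M: "M = {m1, m2}"
    and "common_separations v k m1 = common_separations v k m2"
    using common_separations_eq_iff by blast
  moreover have "common_separations v k m1 \<in> \<nat>"
    using nat M by blast
  ultimately show ?L
    by (auto elim!: Nats_cases)
qed

section \<open>The criterion and the parameters of the new design\<close>

theorem theorem1:
  fixes v b r k l :: nat and B :: "nat \<Rightarrow> nat set" and ps :: "(nat \<times> nat) list"
  assumes "block_design {1..v} B v b r k l"
    and "pair_enumeration {1..v} ps"
  shows "((\<exists>B' v' b' r' k' l'. block_design {1..v'} B' v' b' r' k' l' \<and>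
            zplus_mat b B ps = incidence_mat v' b' B')
         \<longleftrightarrow>
         (\<exists>\<mu>1 \<mu>2 :: nat. intersection_numbers b B = {\<mu>1, \<mu>2} \<and>
            (\<mu>1 = \<mu>2 \<or> real \<mu>1 + real \<mu>2 = 2 * real k - real v / 2)))
       \<and>
         (\<forall>(\<mu>1 :: nat) (\<mu>2 :: nat) B' v' b' r' k' l'.
         intersection_numbers b B = {\<mu>1, \<mu>2} \<and>
         (\<mu>1 = \<mu>2 \<or> real \<mu>1 + real \<mu>2 = 2 * real k - real v / 2) \<and>
         block_design {1..v'} B' v' b' r' k' l' \<and>
         zplus_mat b B ps = incidence_mat v' b' B'
         \<longrightarrow>
         v' = b \<and>
         real b' = real v * (real v - 1) / 2 \<and>
         real r' = real k * (real v - real k) \<and>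
         real k' = 2 * (real r - real l) \<and>
         real l' = 2 * (real \<mu>1)\<^sup>2 + real \<mu>1 * (real v - 4 * real k) + (real k)\<^sup>2 \<and>
         real l' = real k * (real v - real k) * (2 * real r - 2 * real l - 1) / (real b - 1))"
proof -
  have rl: "l < r" and b: "2 \<le> b" and kv: "k < v"
    using block_design_index_less_replication[OF assms(1)] block_design_two_le_blocks[OF assms(1)]
      assms(1) by (simp_all add: block_design_def)
  let ?M = "intersection_numbers b B"
  have "card (B 1 \<inter> B 2) \<in> ?M"
    unfolding intersection_numbers_def using b by force
  then have M: "?M \<noteq> {}"
    by blast
  \<comment> \<open>On intersection numbers the quadratic function counts pairs, so its values are
    natural.\<close>
  have nat: "common_separations v k m \<in> \<nat>" if m: "m \<in> ?M" for m
  proof -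
    obtain i j where ij: "i \<in> {1..b}" "j \<in> {1..b}" "m = card (B i \<inter> B j)"
      using m unfolding intersection_numbers_def by blast
    then have "B i \<subseteq> {1..v}" "B j \<subseteq> {1..v}" "card (B i) = k" "card (B j) = k"
      using assms(1) by (simp_all add: block_design_def)
    from card_common_separations[OF assms(2) finite_atLeastAtMost this]
    have "common_separations v k m =
        real (card {c\<in>{1..length ps}. separates (B i) (ps ! (c - 1)) \<and> separates (B j) (ps ! (c - 1))})"
      using ij(3) by simp
    then show ?thesis
      by simp
  qed
  note iff = block_design_zplus_mat_iff[OF assms]
  show ?thesis
  proof (rule conjI, goal_cases)
    case 1
    have "(\<exists>B' v' b' r' k' l'. block_design {1..v'} B' v' b' r' k' l' \<and>
        zplus_mat b B ps = incidence_mat v' b' B') \<longleftrightarrow>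
      (\<exists>l'. \<forall>m \<in> ?M. common_separations v k m = real l')"
      (is "?D \<longleftrightarrow> ?E")
    proof
      assume ?D
      then show ?E
        by (elim exE) (unfold iff, blast)
    next
      assume ?E
      then obtain l' where "\<forall>m \<in> ?M. common_separations v k m = real l'"
        by blast
      \<comment> \<open>The witnesses are the values that \<open>iff\<close> forces.\<close>
      then have "block_design {1..b} (pair_block b B ps) b (length ps) (k * (v - k)) (2 * (r - l)) l' \<and>
          zplus_mat b B ps = incidence_mat b (length ps) (pair_block b B ps)"
        unfolding iff by simp
      then show ?D
        by blast
    qed
    then show ?case
      by (simp only: common_separations_constant_iff[OF M nat])
  next
    case 2
    have "v' = b \<and> real b' = real v * (real v - 1) / 2 \<and>
        real r' = real k * (real v - real k) \<and> real k' = 2 * (real r - real l) \<and>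
        real l' = 2 * (real \<mu>1)\<^sup>2 + real \<mu>1 * (real v - 4 * real k) + (real k)\<^sup>2 \<and>
        real l' = real k * (real v - real k) * (2 * real r - 2 * real l - 1) / (real b - 1)"
      if \<mu>: "intersection_numbers b B = {\<mu>1, \<mu>2}"
        and D': "block_design {1..v'} B' v' b' r' k' l'"
        and Z: "zplus_mat b B ps = incidence_mat v' b' B'" for \<mu>1 \<mu>2 B' v' b' r' k' l'
    proof -
      have eqs: "v' = b" "b' = length ps" "r' = k * (v - k)" "k' = 2 * (r - l)"
        and sep: "\<forall>m\<in>{\<mu>1, \<mu>2}. common_separations v k m = real l'"
        using D' Z iff[of v' B' b' r' k' l'] unfolding \<mu> by simp_all
      have b': "real b' = real v * (real v - 1) / 2"
        using length_pair_enumeration[OF assms(2)] by (simp add: eqs)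
      have r': "real r' = real k * (real v - real k)"
        using kv by (simp add: eqs)
      have k': "real k' = 2 * (real r - real l)"
        using rl by (simp add: eqs)
      have l': "real l' = 2 * (real \<mu>1)\<^sup>2 + real \<mu>1 * (real v - 4 * real k) + (real k)\<^sup>2"
        using sep by (simp add: common_separations_def)
      \<comment> \<open>The counting identity is applied to the new design, which has
        \<open>b\<close> points; \<open>1 \<le> k'\<close> and \<open>2 \<le> b\<close> then make
        both truncated subtractions exact over the reals.\<close>
      have "r' * (k' - 1) = l' * (b - 1)"
        using block_design_replication_eq[OF D'] by (simp add: eqs(1))
      then have "real r' * real (k' - 1) = real l' * real (b - 1)"
        by (metis of_nat_mult)
      moreover have "1 \<le> k'"
        using rl by (simp add: eqs(4))
      ultimately have "real r' * (real k' - 1) = real l' * (real b - 1)"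
        using b by simp
      then have "real l' = real r' * (real k' - 1) / (real b - 1)"
        using b by (simp add: nonzero_eq_divide_eq)
      then have "real l' = real k * (real v - real k) * (2 * real r - 2 * real l - 1) / (real b - 1)"
        unfolding r' k' by (simp add: algebra_simps)
      then show ?thesis
        using eqs(1) b' r' k' l' by blast
    qed
    then show ?case
      by blast
  qed
qed

end
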